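(* For $N\ge 3$ let two walkers perform independent simple random walks on the circle $\{0,1,\dots,N-1\}$ (indices modulo $N$): at each step, each walker at $i$ independently moves to $i-1$, moves to $i+1$, or stays at $i$, each with probability $\tfrac13$. Let the initial positions be independent and uniformly distributed on the circle, and let $\tau_N$ be the meeting time. Then $\mathbf{E}[\tau_N]=\Theta(N^2)$ as $N\to\infty$; that is, there are constants $0<c\le C$ such that $cN^2\le \mathbf{E}[\tau_N]\le CN^2$ for all sufficiently large $N$.
   Context: Time is discrete and both walkers move simultaneously in each time slot. The meeting time is the first time $t\ge 0$ at which the two walkers are at the same vertex. *)

theory Defs
  imports "HOL-Probability.Probability"
begin

locale markov_chain = prob_space M
  for M :: "'a measure"
    and \<mu> :: "'s :: countable pmf"
    and K :: "'s \<Rightarrow> 's pmf"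
    and X :: "nat \<Rightarrow> 'a \<Rightarrow> 's" +
  assumes X_measurable: "\<And>t. X t \<in> measurable M (count_space UNIV)"
    and X_initial: "distr M (count_space UNIV) (X 0) = measure_pmf \<mu>"
    (* The Markov property with transition kernel K, multiplied out so that
       no conditioning on null events is involved. *)
    and X_markov: "\<And>t x.
      \<P>(\<omega> in M. \<forall>s\<le>Suc t. X s \<omega> = x s) =
      \<P>(\<omega> in M. \<forall>s\<le>t. X s \<omega> = x s) * pmf (K (x t)) (x (Suc t))"

definition circle :: "nat \<Rightarrow> int set" where
  "circle N = {0..<int N}"

definition circle_step :: "nat \<Rightarrow> int \<Rightarrow> int pmf" where
  "circle_step N i = map_pmf (\<lambda>d. (i + d) mod int N) (pmf_of_set {-1, 0, 1})"

locale two_circle_walks = prob_space M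
  for M :: "'a measure"
    and N :: nat
    and X Y :: "nat \<Rightarrow> 'a \<Rightarrow> int" +
  assumes N_ge_3: "N \<ge> 3"
    and X_walk: "markov_chain M (pmf_of_set (circle N)) (circle_step N) X"
    and Y_walk: "markov_chain M (pmf_of_set (circle N)) (circle_step N) Y"
    (* Independence of the two entire trajectories, initial positions included. *)
    and X_Y_indep: "indep_var
      (Pi\<^sub>M UNIV (\<lambda>_. count_space UNIV)) (\<lambda>\<omega> t. X t \<omega>)
      (Pi\<^sub>M UNIV (\<lambda>_. count_space UNIV)) (\<lambda>\<omega> t. Y t \<omega>)"

(* The infimum of the empty set is infinity, so the meeting time of walkers that
   never meet is infinite. *)
definition meeting_time :: "(nat \<Rightarrow> 'a \<Rightarrow> 's) \<Rightarrow> (nat \<Rightarrow> 'a \<Rightarrow> 's) \<Rightarrow> 'a \<Rightarrow> enat" where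
  "meeting_time X Y \<omega> = Inf (enat ` {t. X t \<omega> = Y t \<omega>})"

definition expected_meeting_time ::
    "'a measure \<Rightarrow> (nat \<Rightarrow> 'a \<Rightarrow> 's) \<Rightarrow> (nat \<Rightarrow> 'a \<Rightarrow> 's) \<Rightarrow> ennreal" where
  "expected_meeting_time M X Y = (\<integral>\<^sup>+ \<omega>. ennreal_of_enat (meeting_time X Y \<omega>) \<partial>M)"

(* The locale assumptions are satisfiable: the coordinates of a product space give the
   initial position and the increments of a walk, and two independent copies of that
   space carry the two walks. *)

lemma circle_chain_exists:
  assumes "N \<ge> 3"
  defines "P \<equiv> (\<lambda>n::nat. measure_pmf (if n = 0 then pmf_of_set (circle N) else pmf_of_set {-1, 0, 1::int}))"
  defines "X \<equiv> (\<lambda>t \<omega>. (\<Sum>s\<le>t. \<omega> s) mod int N)"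
  shows "markov_chain (PiM UNIV P) (pmf_of_set (circle N)) (circle_step N) X"
proof -
  let ?W = "PiM UNIV P"
  have P: "prob_space (P n)" for n unfolding P_def by (rule measure_pmf.prob_space_axioms)
  have sP: "sets (P n) = UNIV" for n by (simp add: P_def)
  have spP: "space (P n) = UNIV" for n by (simp add: P_def)
  interpret W: prob_space ?W by (intro prob_space_PiM P)
  have spW: "space ?W = UNIV" by (simp add: space_PiM spP)
  have S: "(\<lambda>\<omega>. \<Sum>s\<le>t. \<omega> s) \<in> measurable (PiM {..t} P) (count_space UNIV)" for t
  proof -
    have c: "(\<lambda>\<omega>. \<omega> n) \<in> measurable (PiM {..t} P) (count_space UNIV)" if "n \<le> t" for n
      using measurable_component_singleton[of n "{..t}" P] that
        measurable_cong_sets[OF refl, of "P n" "count_space UNIV" "PiM {..t} P"] sP by simp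
    have "(\<lambda>\<omega>. \<Sum>s\<le>u. \<omega> s) \<in> measurable (PiM {..t} P) (count_space UNIV)" if "u \<le> t" for u
      using that
    proof (induction u)
      case 0 then show ?case using c[of 0] by simp
    next
      case (Suc u)
      have 1: "(\<lambda>\<omega>. (\<Sum>s\<le>u. \<omega> s)) \<in> measurable (PiM {..t} P) (count_space UNIV)" using Suc by simp
      have 2: "(\<lambda>\<omega>. \<omega> (Suc u)) \<in> measurable (PiM {..t} P) (count_space UNIV)" using c Suc by simp
      have "(\<lambda>\<omega>. (\<Sum>s\<le>u. \<omega> s) + \<omega> (Suc u)) \<in> measurable (PiM {..t} P) (count_space UNIV)"
        by (rule measurable_compose_countable[OF measurable_compose[OF 2 measurable_count_space] 1])
      then show ?case by simp
    qed
    then show ?thesis by simp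
  qed
  have X: "X t \<in> measurable ?W (count_space UNIV)" for t
  proof -
    have "(\<lambda>\<omega>. \<Sum>s\<le>t. restrict \<omega> {..t} s) \<in> measurable ?W (count_space UNIV)"
      by (rule measurable_compose[OF measurable_restrict_subset S]) simp
    then have "(\<lambda>\<omega>. (\<Sum>s\<le>t. \<omega> s)) \<in> measurable ?W (count_space UNIV)" by simp
    then show ?thesis unfolding X_def by measurable
  qed
  have comp: "distr ?W (P n) (\<lambda>\<omega>. \<omega> n) = P n" for n
    by (rule distr_PiM_component) (auto intro: P)
  have ind: "W.indep_vars P (\<lambda>n \<omega>. \<omega> n) UNIV"
    by (subst W.indep_vars_iff_distr_eq_PiM) (auto simp: restrict_def comp distr_id)
  have U: "set_pmf (pmf_of_set (circle N)) = circle N"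
    using assms by (intro set_pmf_of_set) (auto simp: circle_def)
  show ?thesis
  proof
    show "X t \<in> measurable ?W (count_space UNIV)" for t by (rule X)
    have "distr ?W (count_space UNIV) (X 0) = distr (distr ?W (P 0) (\<lambda>\<omega>. \<omega> 0)) (count_space UNIV) (\<lambda>i. i mod int N)"
      by (subst distr_distr) (auto simp: X_def o_def P_def intro!: measurable_component_singleton)
    also have "\<dots> = measure_pmf (map_pmf (\<lambda>i. i mod int N) (pmf_of_set (circle N)))"
      unfolding comp by (simp add: P_def map_pmf_rep_eq)
    also have "map_pmf (\<lambda>i. i mod int N) (pmf_of_set (circle N)) = map_pmf (\<lambda>i. i) (pmf_of_set (circle N))"
      by (rule map_pmf_cong) (simp_all add: U, simp add: circle_def)
    finally show "distr ?W (count_space UNIV) (X 0) = measure_pmf (pmf_of_set (circle N))" by simp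
  next
    fix t :: nat and x :: "nat \<Rightarrow> int"
    define A where "A = {\<omega> \<in> space (PiM {..t} P). \<forall>s\<le>t. (\<Sum>r\<le>s. \<omega> r) mod int N = x s}"
    define B where "B = {d. (x t + d) mod int N = x (Suc t)}"
    have Xr: "X s \<omega> = (\<Sum>r\<le>s. restrict \<omega> {..t} r) mod int N" if "s \<le> t" for s \<omega>
      using that unfolding X_def by (intro arg_cong2[where f="(mod)"] sum.cong) auto
    have Ain: "restrict \<omega> {..t} \<in> A \<longleftrightarrow> (\<forall>s\<le>t. X s \<omega> = x s)" for \<omega>
      using Xr by (auto simp: A_def space_PiM spP)
    have Am: "A \<in> sets (PiM {..t} P)"
    proof -
      have "(\<lambda>\<omega>. \<Sum>r\<le>s. \<omega> r) \<in> measurable (PiM {..t} P) (count_space UNIV)" if "s \<le> t" for s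
      proof -
        have "(\<lambda>\<omega>. \<Sum>r\<le>s. restrict \<omega> {..s} r) \<in> measurable (PiM {..t} P) (count_space UNIV)"
          by (rule measurable_compose[OF measurable_restrict_subset S]) (use that in simp)
        then show ?thesis by simp
      qed
      note this[measurable]
      have "A = {\<omega> \<in> space (PiM {..t} P). \<forall>s\<in>{..t}. (\<Sum>r\<le>s. \<omega> r) mod int N = x s}"
        by (auto simp: A_def)
      also have "\<dots> \<in> sets (PiM {..t} P)"
        by (intro sets.sets_Collect_finite_All') (auto)
      finally show ?thesis .
    qed
    have ab: "W.indep_var (PiM {..t} P) (\<lambda>\<omega>. restrict \<omega> {..t}) (PiM {Suc t} P) (\<lambda>\<omega>. restrict \<omega> {Suc t})"
      using W.indep_var_restrict[OF ind, of "{..t}" "{Suc t}"] by simp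
    define B' where "B' = (\<lambda>f. f (Suc t)) -` B \<inter> space (PiM {Suc t} P)"
    have Bm: "B' \<in> sets (PiM {Suc t} P)"
      unfolding B'_def by (rule measurable_sets[of _ _ "P (Suc t)"]) (auto simp: sP)
    have Bin: "restrict \<omega> {Suc t} \<in> B' \<longleftrightarrow> \<omega> (Suc t) \<in> B" for \<omega>
      by (auto simp: B'_def space_PiM spP)
    have step: "X (Suc t) \<omega> = (X t \<omega> + \<omega> (Suc t)) mod int N" for \<omega>
      by (simp add: X_def mod_add_left_eq)
    have Suc_iff: "(\<forall>s\<le>Suc t. X s \<omega> = x s) \<longleftrightarrow>
        (\<forall>s\<le>t. X s \<omega> = x s) \<and> \<omega> (Suc t) \<in> B" for \<omega>
    proof -
      have "(\<forall>s\<le>Suc t. X s \<omega> = x s) \<longleftrightarrow> (\<forall>s\<le>t. X s \<omega> = x s) \<and> X (Suc t) \<omega> = x (Suc t)"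
        unfolding le_Suc_eq by blast
      also have "\<dots> \<longleftrightarrow> (\<forall>s\<le>t. X s \<omega> = x s) \<and> \<omega> (Suc t) \<in> B"
        by (intro conj_cong) (simp_all add: B_def step)
      finally show ?thesis .
    qed
    have "{\<omega> \<in> space ?W. \<forall>s\<le>Suc t. X s \<omega> = x s} =
      (\<lambda>\<omega>. (restrict \<omega> {..t}, restrict \<omega> {Suc t})) -` (A \<times> B') \<inter> space ?W"
      by (auto simp: spW Ain Bin Suc_iff)
    then have "\<P>(\<omega> in ?W. \<forall>s\<le>Suc t. X s \<omega> = x s) =
       W.prob ((\<lambda>\<omega>. (restrict \<omega> {..t}, restrict \<omega> {Suc t})) -` (A \<times> B') \<inter> space ?W)" by simp
    also have "\<dots> = W.prob ((\<lambda>\<omega>. restrict \<omega> {..t}) -` A \<inter> space ?W) * W.prob ((\<lambda>\<omega>. restrict \<omega> {Suc t}) -` B' \<inter> space ?W)"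
      by (rule W.indep_varD[OF ab Am Bm])
    also have "(\<lambda>\<omega>. restrict \<omega> {..t}) -` A \<inter> space ?W = {\<omega> \<in> space ?W. \<forall>s\<le>t. X s \<omega> = x s}"
      by (auto simp: Ain)
    also have "(\<lambda>\<omega>. restrict \<omega> {Suc t}) -` B' \<inter> space ?W = (\<lambda>\<omega>. \<omega> (Suc t)) -` B \<inter> space ?W"
      by (auto simp: Bin)
    also have "W.prob ((\<lambda>\<omega>. \<omega> (Suc t)) -` B \<inter> space ?W) = measure (distr ?W (P (Suc t)) (\<lambda>\<omega>. \<omega> (Suc t))) B"
      by (rule measure_distr[symmetric]) (auto simp: sP intro!: measurable_component_singleton)
    also have "\<dots> = pmf (circle_step N (x t)) (x (Suc t))"
      unfolding comp circle_step_def pmf_map by (simp add: P_def B_def vimage_def)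
    finally show "\<P>(\<omega> in ?W. \<forall>s\<le>Suc t. X s \<omega> = x s) =
      \<P>(\<omega> in ?W. \<forall>s\<le>t. X s \<omega> = x s) * pmf (circle_step N (x t)) (x (Suc t))" .
  qed
qed

lemma markov_chain_distr:
  fixes X :: "nat \<Rightarrow> 'a \<Rightarrow> 's :: countable"
  assumes M: "prob_space M" and f: "f \<in> measurable M W" and D: "distr M W f = W"
    and X: "markov_chain W \<mu> K X"
  shows "markov_chain M \<mu> K (\<lambda>t \<omega>. X t (f \<omega>))"
proof -
  interpret M: prob_space M by fact
  interpret X: markov_chain W \<mu> K X by fact
  note [measurable] = f X.X_measurable
  have prob: "\<P>(\<omega> in M. \<forall>s\<le>t. X s (f \<omega>) = x s) = \<P>(\<omega> in W. \<forall>s\<le>t. X s \<omega> = x s)" for t x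
  proof -
    have m: "{\<omega> \<in> space W. \<forall>s\<le>t. X s \<omega> = x s} \<in> sets W" by measurable
    have "\<P>(\<omega> in W. \<forall>s\<le>t. X s \<omega> = x s) = measure (distr M W f) {\<omega> \<in> space W. \<forall>s\<le>t. X s \<omega> = x s}"
      unfolding D ..
    also have "\<dots> = \<P>(\<omega> in M. \<forall>s\<le>t. X s (f \<omega>) = x s)"
      using measurable_space[OF f]
      by (subst measure_distr[OF f m]) (auto intro!: arg_cong[where f="measure M"])
    finally show ?thesis ..
  qed
  show ?thesis
  proof
    show "(\<lambda>\<omega>. X t (f \<omega>)) \<in> measurable M (count_space UNIV)" for t by measurable
    have "distr M (count_space UNIV) (\<lambda>\<omega>. X 0 (f \<omega>)) = distr (distr M W f) (count_space UNIV) (X 0)"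
      by (subst distr_distr) (auto simp: o_def)
    then show "distr M (count_space UNIV) (\<lambda>\<omega>. X 0 (f \<omega>)) = measure_pmf \<mu>"
      by (simp add: D X.X_initial)
  qed (simp only: prob X.X_markov)
qed

lemma two_circle_walks_exist:
  assumes "N \<ge> 3"
  shows "\<exists>(M :: ((nat \<Rightarrow> int) \<times> (nat \<Rightarrow> int)) measure) X Y. two_circle_walks M N X Y"
proof -
  obtain W :: "(nat \<Rightarrow> int) measure" and X
    where X: "markov_chain W (pmf_of_set (circle N)) (circle_step N) X"
    using circle_chain_exists[OF assms] by blast
  interpret X: markov_chain W "pmf_of_set (circle N)" "circle_step N" X by fact
  interpret pair_prob_space W W ..
  let ?M = "W \<Otimes>\<^sub>M W" and ?S = "PiM UNIV (\<lambda>_::nat. count_space (UNIV :: int set))"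
  have d1: "distr ?M W fst = W" by (rule X.distr_pair_fst)
  have d2: "distr ?M W snd = W"
    by (subst distr_pair_swap) (simp add: distr_distr o_def case_prod_beta X.distr_pair_fst)
  have m: "(\<lambda>\<omega> t. X t \<omega>) \<in> measurable W ?S"
    using X.X_measurable by (intro measurable_PiM_single') auto
  have fs: "indep_var W fst W snd"
    by (subst indep_var_distribution_eq) (simp add: d1 d2 distr_id)
  have "indep_var ?S ((\<lambda>\<omega> t. X t \<omega>) \<circ> fst) ?S ((\<lambda>\<omega> t. X t \<omega>) \<circ> snd)"
    by (rule indep_var_compose[OF fs m m])
  then have indep: "indep_var ?S (\<lambda>\<omega> t. X t (fst \<omega>)) ?S (\<lambda>\<omega> t. X t (snd \<omega>))"
    by (simp only: o_def)
  have "two_circle_walks ?M N (\<lambda>t \<omega>. X t (fst \<omega>)) (\<lambda>t \<omega>. X t (snd \<omega>))"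
  proof (intro two_circle_walks.intro two_circle_walks_axioms.intro prob_space_axioms)
    show "N \<ge> 3" by fact
    show "markov_chain ?M (pmf_of_set (circle N)) (circle_step N) (\<lambda>t \<omega>. X t (fst \<omega>))"
      by (rule markov_chain_distr[OF prob_space_axioms measurable_fst d1 X])
    show "markov_chain ?M (pmf_of_set (circle N)) (circle_step N) (\<lambda>t \<omega>. X t (snd \<omega>))"
      by (rule markov_chain_distr[OF prob_space_axioms measurable_snd d2 X])
  qed (rule indep)
  then show ?thesis by blast
qed

end

theory Submission
  imports Defs
begin

text \<open>
  The difference \<open>d\<close> of the walkers is a walk on the circle with increments \<open>0, \<plusminus>1, \<plusminus>2\<close> of
  probabilities \<open>3/9, 2/9, 1/9\<close>, hence of variance \<open>4/3\<close>, and it is absorbed at \<open>0\<close>.  The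
  function \<open>d (N - d)\<close> has drift at least \<open>-4/3\<close>: equality fails only when the walk jumps over
  \<open>0\<close>, where reduction modulo \<open>N\<close> increases the value.  This gives the lower bound.  For the
  upper bound the gain from such a jump, \<open>2N\<close> with probability \<open>1/9\<close> from \<open>d = 1\<close>, must be
  offset: adding the constant \<open>N\<close> off the absorbing state loses exactly \<open>N\<close> with probability
  \<open>2/9\<close> there, so that \<open>d (N - d) + N\<close> has drift at most \<open>-4/3\<close> everywhere.
\<close>

section \<open>Drift bounds for killed Markov chains\<close>

context markov_chain
begin

text \<open>Histories list the most recent state first, so that \<open>hd\<close> is the current state.\<close>

primrec history :: "nat \<Rightarrow> 'a \<Rightarrow> 's list" where
  "history 0 \<omega> = [X 0 \<omega>]"
| "history (Suc t) \<omega> = X (Suc t) \<omega> # history t \<omega>"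

lemma length_history [simp]: "length (history t \<omega>) = Suc t"
  by (induction t) auto

lemma hd_history [simp]: "hd (history t \<omega>) = X t \<omega>"
  by (cases t) auto

lemma set_history: "set (history t \<omega>) = (\<lambda>s. X s \<omega>) ` {..t}"
  by (induction t) (auto simp: atMost_Suc)

lemma history_nth: "s \<le> t \<Longrightarrow> history t \<omega> ! (t - s) = X s \<omega>"
proof (induction t)
  case (Suc t)
  then show ?case by (cases "s = Suc t") (auto simp: Suc_diff_le)
qed auto

lemma history_eq_iff:
  assumes "length h = Suc t"
  shows "history t \<omega> = h \<longleftrightarrow> (\<forall>s\<le>t. X s \<omega> = h ! (t - s))"
proof
  assume *: "\<forall>s\<le>t. X s \<omega> = h ! (t - s)"
  show "history t \<omega> = h"
  proof (rule nth_equalityI)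
    fix i assume "i < length (history t \<omega>)"
    then have "i = t - (t - i)" by simp
    then show "history t \<omega> ! i = h ! i"
      using history_nth[of "t - i" t \<omega>] * by (metis diff_le_self)
  qed (simp add: assms)
qed (auto simp: history_nth)

lemma history_measurable [measurable]: "history t \<in> measurable M (count_space UNIV)"
proof (induction t)
  case 0
  show ?case using X_measurable[of 0] by (simp add: measurable_compose[OF _ measurable_count_space, of "X 0" M])
next
  case (Suc t)
  have "(\<lambda>\<omega>. (\<lambda>h \<omega>. X (Suc t) \<omega> # h) (history t \<omega>) \<omega>) \<in> measurable M (count_space UNIV)"
    by (rule measurable_compose_countable[OF measurable_compose[OF X_measurable measurable_count_space] Suc])
  then show ?case by simp
qed

text \<open>The law that the history ought to have, with only the head entering the next step. The
  \<open>bind_pmf\<close> recursion allows integration over one further step, which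
  \<open>X_markov\<close> gives only cylinder by cylinder.\<close>

primrec history_pmf :: "nat \<Rightarrow> 's list pmf" where
  "history_pmf 0 = map_pmf (\<lambda>x. [x]) \<mu>"
| "history_pmf (Suc t) = bind_pmf (history_pmf t) (\<lambda>h. map_pmf (\<lambda>x. x # h) (K (hd h)))"

lemma pmf_history_Suc:
  "pmf (history_pmf (Suc t)) (x # h) = pmf (history_pmf t) h * pmf (K (hd h)) x"
proof -
  \<comment> \<open>Consing is injective, so only the past \<open>h' = h\<close> contributes to the
    bind.\<close>
  have "pmf (map_pmf (\<lambda>x. x # h') (K (hd h'))) (x # h) = indicator {h} h' * pmf (K (hd h)) x" for h'
    using pmf_map_inj'[of "\<lambda>x. x # h" "K (hd h)" x]
    by (auto simp: indicator_def inj_def pmf_eq_0_set_pmf)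
  then show ?thesis
    by (simp add: pmf_bind measure_pmf_single)
qed

text \<open>\<open>X_markov\<close>, read along the entries of \<open>h\<close>, is the recursion
  \<open>pmf_history_Suc\<close>; lists whose length is not \<open>Suc t\<close> have mass zero on
  both sides.\<close>

lemma prob_history: "\<P>(\<omega> in M. history t \<omega> = h) = pmf (history_pmf t) h"
proof (induction t arbitrary: h)
  case 0
  show ?case
  proof (cases "\<exists>x. h = [x]")
    case True
    then obtain x where h: "h = [x]" ..
    have "\<P>(\<omega> in M. history 0 \<omega> = h) = measure (distr M (count_space UNIV) (X 0)) {x}"
      using X_measurable by (subst measure_distr) (auto simp: h intro!: arg_cong[where f=prob])
    also have "\<dots> = pmf (history_pmf 0) h"
      using pmf_map_inj'[of "\<lambda>x. [x]" \<mu> x] by (simp add: X_initial h measure_pmf_single inj_def)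
    finally show ?thesis .
  next
    case False
    then have "pmf (history_pmf 0) h = 0" by (auto simp: pmf_eq_0_set_pmf)
    moreover have "history 0 \<omega> \<noteq> h" for \<omega> using False by auto
    ultimately show ?thesis by simp
  qed
next
  case (Suc t)
  show ?case
  proof (cases h)
    case Nil
    then have "pmf (history_pmf (Suc t)) h = 0" by (auto simp: pmf_eq_0_set_pmf)
    then show ?thesis using Nil by simp
  next
    case (Cons x h')
    show ?thesis
    proof (cases "length h' = Suc t")
      case True
      have "\<P>(\<omega> in M. history (Suc t) \<omega> = h) = \<P>(\<omega> in M. \<forall>s\<le>Suc t. X s \<omega> = h ! (Suc t - s))"
        using True Cons by (subst history_eq_iff) auto
      also have "\<dots> = \<P>(\<omega> in M. \<forall>s\<le>t. X s \<omega> = h ! (Suc t - s)) * pmf (K (h ! (Suc t - t))) (h ! (Suc t - Suc t))"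
        by (rule X_markov)
      also have "{\<omega> \<in> space M. \<forall>s\<le>t. X s \<omega> = h ! (Suc t - s)} = {\<omega> \<in> space M. history t \<omega> = h'}"
        using True by (subst history_eq_iff) (auto simp: Cons Suc_diff_le)
      also have "h ! (Suc t - t) = hd h'" using True by (cases h') (auto simp: Cons)
      finally show ?thesis using Suc by (simp add: Cons pmf_history_Suc del: history_pmf.simps)
    next
      case False
      \<comment> \<open>The induction hypothesis at \<open>h'\<close> now yields
        \<open>pmf (history_pmf t) h' = 0\<close>.\<close>
      then have "history t \<omega> \<noteq> h'" for \<omega> using length_history by metis
      then show ?thesis using Suc[of h'] by (simp add: Cons pmf_history_Suc del: history_pmf.simps)
    qed
  qed
qed

lemma distr_history: "distr M (count_space UNIV) (history t) = measure_pmf (history_pmf t)"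
proof (rule measure_eqI_countable[where A=UNIV])
  fix h
  have "emeasure (distr M (count_space UNIV) (history t)) {h} = ennreal (\<P>(\<omega> in M. history t \<omega> = h))"
    by (subst emeasure_distr) (auto simp: emeasure_eq_measure intro!: arg_cong[where f=prob])
  then show "emeasure (distr M (count_space UNIV) (history t)) {h} = emeasure (history_pmf t) {h}"
    by (simp only: prob_history emeasure_pmf_single)
qed auto

text \<open>The Markov property in integrated form. \<open>F\<close> takes the whole history because
  survival is a condition on the past.\<close>

lemma nn_integral_history_Suc:
  fixes F :: "'s list \<Rightarrow> ennreal"
  shows "(\<integral>\<^sup>+ \<omega>. F (history (Suc t) \<omega>) \<partial>M) =
    (\<integral>\<^sup>+ \<omega>. (\<integral>\<^sup>+ x. F (x # history t \<omega>) \<partial>K (X t \<omega>)) \<partial>M)"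
proof -
  have d: "(\<integral>\<^sup>+ \<omega>. G (history s \<omega>) \<partial>M) = (\<integral>\<^sup>+ h. G h \<partial>history_pmf s)" for s and G :: "'s list \<Rightarrow> ennreal"
    unfolding distr_history[symmetric] by (subst nn_integral_distr) auto
  show ?thesis
    using d[of "\<lambda>h. \<integral>\<^sup>+ x. F (x # h) \<partial>K (hd h)" t]
    by (subst d) (simp add: nn_integral_bind_pmf)
qed


text \<open>Confines the chain to a closed set such as the circle, so that drift inequalities are
  required only there.\<close>

lemma AE_closed:
  assumes "set_pmf \<mu> \<subseteq> S" "\<And>x. x \<in> S \<Longrightarrow> set_pmf (K x) \<subseteq> S"
  shows "AE \<omega> in M. X t \<omega> \<in> S"
proof -
  have "\<forall>h\<in>set_pmf (history_pmf t). hd h \<in> S"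
    by (induction t) (use assms in auto)
  then have "AE h in distr M (count_space UNIV) (history t). hd h \<in> S"
    unfolding distr_history AE_measure_pmf_iff .
  then show ?thesis
    by (subst (asm) AE_distr_iff) auto
qed

section \<open>Survival probabilities and killed expectations\<close>

definition survival :: "'s set \<Rightarrow> nat \<Rightarrow> ennreal" where
  "survival A t = emeasure M {\<omega> \<in> space M. \<forall>s\<le>t. X s \<omega> \<notin> A}"

text \<open>With \<open>T\<close> the hitting time of \<open>A\<close>, this is the expectation of
  \<open>g (X t)\<close> on the event \<open>T > t\<close>, whose probability is
  \<open>survival A t\<close>.\<close>

definition killed :: "'s set \<Rightarrow> ('s \<Rightarrow> ennreal) \<Rightarrow> nat \<Rightarrow> ennreal" where
  "killed A g t = (\<integral>\<^sup>+ \<omega>. (if \<forall>s\<le>t. X s \<omega> \<notin> A then g (X t \<omega>) else 0) \<partial>M)"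

lemma alive_measurable [measurable]: "Measurable.pred M (\<lambda>\<omega>. \<forall>s\<le>t. X s \<omega> \<notin> A)"
proof -
  note X_measurable [measurable]
  show ?thesis by measurable
qed

lemma killed_measurable [measurable]:
  fixes g :: "'s \<Rightarrow> ennreal"
  shows "(\<lambda>\<omega>. if \<forall>s\<le>t. X s \<omega> \<notin> A then g (X t \<omega>) else 0) \<in> borel_measurable M"
proof -
  note X_measurable [measurable]
  show ?thesis by measurable
qed

lemma survival_eq_killed: "survival A t = killed A (\<lambda>_. 1) t"
proof -
  have "survival A t = (\<integral>\<^sup>+ \<omega>. indicator {\<omega> \<in> space M. \<forall>s\<le>t. X s \<omega> \<notin> A} \<omega> \<partial>M)"
    unfolding survival_def by (rule nn_integral_indicator[OF predE[OF alive_measurable], symmetric])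
  also have "\<dots> = killed A (\<lambda>_. 1) t"
    unfolding killed_def by (intro nn_integral_cong) (auto simp: indicator_def)
  finally show ?thesis .
qed

lemma killed_0:
  assumes "\<And>x. x \<in> A \<Longrightarrow> g x = 0"
  shows "killed A g 0 = (\<integral>\<^sup>+ x. g x \<partial>\<mu>)"
proof -
  have "killed A g 0 = (\<integral>\<^sup>+ \<omega>. g (X 0 \<omega>) \<partial>M)"
    unfolding killed_def using assms by (intro nn_integral_cong) auto
  also have "\<dots> = (\<integral>\<^sup>+ x. g x \<partial>distr M (count_space UNIV) (X 0))"
    using X_measurable by (subst nn_integral_distr) auto
  finally show ?thesis by (simp only: X_initial)
qed

text \<open>Conditioning on the history up to \<open>t\<close> takes survival up to \<open>t\<close>
  out of the inner integral. Survival at \<open>Suc t\<close> needs no indicator there, since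
  \<open>g\<close> vanishes on \<open>A\<close>.\<close>

lemma killed_Suc:
  assumes "\<And>x. x \<in> A \<Longrightarrow> g x = 0"
  shows "killed A g (Suc t) = killed A (\<lambda>x. \<integral>\<^sup>+ y. g y \<partial>K x) t"
proof -
  define F where "F h = (if set h \<inter> A = {} then g (hd h) else 0)" for h
  have if_out: "(\<integral>\<^sup>+ y. (if P then g y else 0) \<partial>p) = (if P then \<integral>\<^sup>+ y. g y \<partial>p else 0)"
    for P and p :: "'s measure" by simp
  have alive: "set (history t \<omega>) \<inter> A = {} \<longleftrightarrow> (\<forall>s\<le>t. X s \<omega> \<notin> A)" for t \<omega>
    by (auto simp: set_history)
  have "killed A g (Suc t) = (\<integral>\<^sup>+ \<omega>. F (history (Suc t) \<omega>) \<partial>M)"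
    unfolding killed_def F_def alive hd_history ..
  also have "\<dots> = (\<integral>\<^sup>+ \<omega>. (\<integral>\<^sup>+ x. F (x # history t \<omega>) \<partial>K (X t \<omega>)) \<partial>M)"
    by (rule nn_integral_history_Suc)
  also have "F (x # history t \<omega>) = (if \<forall>s\<le>t. X s \<omega> \<notin> A then g x else 0)" for x \<omega>
    using assms alive[of t \<omega>] by (auto simp: F_def)
  then have "(\<integral>\<^sup>+ x. F (x # history t \<omega>) \<partial>K (X t \<omega>)) =
      (if \<forall>s\<le>t. X s \<omega> \<notin> A then \<integral>\<^sup>+ y. g y \<partial>K (X t \<omega>) else 0)" for \<omega>
    by (simp only: if_out)
  then have "(\<integral>\<^sup>+ \<omega>. (\<integral>\<^sup>+ x. F (x # history t \<omega>) \<partial>K (X t \<omega>)) \<partial>M) = killed A (\<lambda>x. \<integral>\<^sup>+ y. g y \<partial>K x) t"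
    unfolding killed_def by simp
  finally show ?thesis .
qed

lemma killed_mono:
  assumes "set_pmf \<mu> \<subseteq> S" "\<And>x. x \<in> S \<Longrightarrow> set_pmf (K x) \<subseteq> S"
    and "\<And>x. x \<in> S - A \<Longrightarrow> f x \<le> g x"
  shows "killed A f t \<le> killed A g t"
  unfolding killed_def
  using AE_closed[OF assms(1,2), of t]
  by (intro nn_integral_mono_AE) (auto elim!: eventually_mono intro!: assms(3))

lemma killed_add_const: "killed A (\<lambda>x. f x + c) t = killed A f t + c * survival A t"
proof -
  have linear: "(\<integral>\<^sup>+ \<omega>. p \<omega> + c * q \<omega> \<partial>M) = (\<integral>\<^sup>+ \<omega>. p \<omega> \<partial>M) + c * (\<integral>\<^sup>+ \<omega>. q \<omega> \<partial>M)"
    if "p \<in> borel_measurable M" "q \<in> borel_measurable M" for p q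
    using that by (simp add: nn_integral_add nn_integral_cmult)
  have "killed A (\<lambda>x. f x + c) t =
      (\<integral>\<^sup>+ \<omega>. (if \<forall>s\<le>t. X s \<omega> \<notin> A then f (X t \<omega>) else 0) + c * (if \<forall>s\<le>t. X s \<omega> \<notin> A then 1 else 0) \<partial>M)"
    unfolding killed_def by (intro nn_integral_cong) auto
  also have "\<dots> = killed A f t + c * survival A t"
    unfolding survival_eq_killed killed_def
    by (rule linear[OF killed_measurable killed_measurable])
  finally show ?thesis .
qed

text \<open>The drift inequality, integrated over surviving paths, telescopes; the nonnegative
  boundary term \<open>killed A g t\<close> is dropped. As \<open>t\<close> grows, the sum tends to
  the expected hitting time.\<close>

lemma killed_le_supermartingale:
  assumes "set_pmf \<mu> \<subseteq> S" "\<And>x. x \<in> S \<Longrightarrow> set_pmf (K x) \<subseteq> S"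
    and g0: "\<And>x. x \<in> A \<Longrightarrow> g x = 0"
    and drift: "\<And>x. x \<in> S - A \<Longrightarrow> (\<integral>\<^sup>+ y. g y \<partial>K x) + c \<le> g x"
  shows "c * (\<Sum>s<t. survival A s) \<le> (\<integral>\<^sup>+ x. g x \<partial>\<mu>)"
proof -
  have "killed A g t + c * (\<Sum>s<t. survival A s) \<le> killed A g 0"
  proof (induction t)
    case (Suc t)
    have step: "killed A g (Suc t) = killed A (\<lambda>x. \<integral>\<^sup>+ y. g y \<partial>K x) t"
      by (rule killed_Suc) (rule g0)
    have "killed A g (Suc t) + c * survival A t \<le> killed A g t"
      unfolding step killed_add_const[symmetric]
      using assms(1,2) drift by (rule killed_mono)
    then have "killed A g (Suc t) + c * survival A t + c * (\<Sum>s<t. survival A s) \<le>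
        killed A g t + c * (\<Sum>s<t. survival A s)"
      by (rule add_right_mono)
    from order_trans[OF this Suc] show ?case by (simp add: algebra_simps)
  qed simp
  then have "killed A g t + c * (\<Sum>s<t. survival A s) \<le> (\<integral>\<^sup>+ x. g x \<partial>\<mu>)"
    using killed_0[of A g, OF g0] by simp
  then show ?thesis
    by (rule order_trans[rotated]) (simp add: add_increasing)
qed

text \<open>The same telescoping with the inequality reversed; here the boundary term has to
  stay.\<close>

lemma killed_ge_submartingale:
  assumes "set_pmf \<mu> \<subseteq> S" "\<And>x. x \<in> S \<Longrightarrow> set_pmf (K x) \<subseteq> S"
    and g0: "\<And>x. x \<in> A \<Longrightarrow> g x = 0"
    and drift: "\<And>x. x \<in> S - A \<Longrightarrow> g x \<le> (\<integral>\<^sup>+ y. g y \<partial>K x) + c"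
  shows "(\<integral>\<^sup>+ x. g x \<partial>\<mu>) \<le> killed A g t + c * (\<Sum>s<t. survival A s)"
proof -
  have "killed A g 0 \<le> killed A g t + c * (\<Sum>s<t. survival A s)"
  proof (induction t)
    case (Suc t)
    have step: "killed A g (Suc t) = killed A (\<lambda>x. \<integral>\<^sup>+ y. g y \<partial>K x) t"
      by (rule killed_Suc) (rule g0)
    have "killed A g t \<le> killed A g (Suc t) + c * survival A t"
      unfolding step killed_add_const[symmetric]
      using assms(1,2) drift by (rule killed_mono)
    then have "killed A g t + c * (\<Sum>s<t. survival A s) \<le>
        killed A g (Suc t) + c * survival A t + c * (\<Sum>s<t. survival A s)"
      by (rule add_right_mono)
    with Suc have "killed A g 0 \<le> killed A g (Suc t) + c * survival A t + c * (\<Sum>s<t. survival A s)"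
      by (rule order_trans)
    then show ?case by (simp add: algebra_simps)
  qed simp
  then show ?thesis using killed_0[of A g, OF g0] by simp
qed

lemma survival_antimono: "s \<le> t \<Longrightarrow> survival A t \<le> survival A s"
  unfolding survival_def
  by (rule emeasure_mono[OF Collect_mono predE[OF alive_measurable]]) (metis order_trans)

text \<open>Survival probabilities decrease in time, so each of the \<open>t\<close> summands is at
  least the value at \<open>t\<close>.\<close>

lemma sum_survival_ge: "of_nat t * survival A t \<le> (\<Sum>s<t. survival A s)"
  using sum_bounded_below[of "{..<t}" "survival A t" "survival A"] survival_antimono by simp

text \<open>Taking \<open>t = n\<close> in the submartingale bound, the boundary term is at most \<open>n\<close> times the
  survival probability at time \<open>n\<close>, which is at most the sum of the first \<open>n\<close> survival
  probabilities; so no almost sure finiteness of the hitting time is needed.\<close>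

lemma sum_survival_lower_bound:
  assumes "set_pmf \<mu> \<subseteq> S" "\<And>x. x \<in> S \<Longrightarrow> set_pmf (K x) \<subseteq> S"
    and g0: "\<And>x. x \<in> A \<Longrightarrow> g x = 0"
    and drift: "\<And>x. x \<in> S - A \<Longrightarrow> g x \<le> (\<integral>\<^sup>+ y. g y \<partial>K x) + c"
    and bound: "\<And>x. x \<in> S \<Longrightarrow> g x \<le> of_nat n"
  shows "(\<integral>\<^sup>+ x. g x \<partial>\<mu>) \<le> (1 + c) * (\<Sum>s<n. survival A s)"
proof -
  \<comment> \<open>The bound is written \<open>0 + of_nat n\<close> to match
    \<open>killed_add_const\<close> with the zero function.\<close>
  have "killed A g n \<le> killed A (\<lambda>x. 0 + of_nat n) n"
    using assms by (intro killed_mono[of S]) auto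
  also have "\<dots> = of_nat n * survival A n"
    unfolding killed_add_const by (simp add: killed_def)
  also have "\<dots> \<le> (\<Sum>s<n. survival A s)" by (rule sum_survival_ge)
  finally have k: "killed A g n \<le> (\<Sum>s<n. survival A s)" .
  have "(\<integral>\<^sup>+ x. g x \<partial>\<mu>) \<le> killed A g n + c * (\<Sum>s<n. survival A s)"
    using assms(1-4) by (rule killed_ge_submartingale)
  also have "\<dots> \<le> (\<Sum>s<n. survival A s) + c * (\<Sum>s<n. survival A s)"
    using k by (rule add_right_mono)
  finally show ?thesis by (simp add: algebra_simps)
qed

end

section \<open>The pair of walkers\<close>

text \<open>Independence factors the probability of a joint cylinder into those of the coordinate
  cylinders; the initial law and the Markov property of the pair both follow from this
  factorisation.\<close>

lemma markov_chain_pair: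
  fixes X Y :: "nat \<Rightarrow> 'a \<Rightarrow> 's :: countable"
  assumes "markov_chain M \<mu> K X" "markov_chain M \<nu> L Y"
    and indep: "prob_space.indep_var M
      (Pi\<^sub>M UNIV (\<lambda>_. count_space UNIV)) (\<lambda>\<omega> t. X t \<omega>)
      (Pi\<^sub>M UNIV (\<lambda>_. count_space UNIV)) (\<lambda>\<omega> t. Y t \<omega>)"
  shows "markov_chain M (pair_pmf \<mu> \<nu>) (\<lambda>(x, y). pair_pmf (K x) (L y)) (\<lambda>t \<omega>. (X t \<omega>, Y t \<omega>))"
proof -
  interpret X: markov_chain M \<mu> K X by fact
  interpret Y: markov_chain M \<nu> L Y by fact
  note [measurable] = X.X_measurable Y.X_measurable
  have cylinder: "{f. \<forall>s\<le>t. f s = x s} \<in> sets (Pi\<^sub>M UNIV (\<lambda>_. count_space UNIV))"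
    for t :: nat and x :: "nat \<Rightarrow> 's"
  proof -
    have "{f \<in> space (Pi\<^sub>M UNIV (\<lambda>_. count_space UNIV)). \<forall>s\<in>{..t}. f s = x s}
        \<in> sets (Pi\<^sub>M UNIV (\<lambda>_. count_space UNIV))"
      by measurable
    then show ?thesis by (simp add: space_PiM Ball_def)
  qed
  have prod: "\<P>(\<omega> in M. \<forall>s\<le>t. (X s \<omega>, Y s \<omega>) = z s) =
      \<P>(\<omega> in M. \<forall>s\<le>t. X s \<omega> = fst (z s)) * \<P>(\<omega> in M. \<forall>s\<le>t. Y s \<omega> = snd (z s))" for t z
  proof -
    have "\<P>(\<omega> in M. \<forall>s\<le>t. (X s \<omega>, Y s \<omega>) = z s) =
        X.prob ((\<lambda>\<omega>. (\<lambda>t. X t \<omega>, \<lambda>t. Y t \<omega>)) -`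
          ({f. \<forall>s\<le>t. f s = fst (z s)} \<times> {f. \<forall>s\<le>t. f s = snd (z s)}) \<inter> space M)"
      by (intro arg_cong[where f=X.prob]) (auto simp: prod_eq_iff)
    also have "\<dots> = X.prob ((\<lambda>\<omega> t. X t \<omega>) -` {f. \<forall>s\<le>t. f s = fst (z s)} \<inter> space M) *
        X.prob ((\<lambda>\<omega> t. Y t \<omega>) -` {f. \<forall>s\<le>t. f s = snd (z s)} \<inter> space M)"
      by (rule X.indep_varD[OF indep cylinder cylinder])
    finally show ?thesis by (simp add: vimage_def Int_def conj_commute)
  qed
  \<comment> \<open>Time zero is phrased as a cylinder over \<open>s \<le> 0\<close>, so that
    \<open>prod\<close> also yields the joint initial law.\<close>
  have init: "\<P>(\<omega> in M. \<forall>s\<le>0. X s \<omega> = x s) = pmf \<mu> (x 0)" for x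
  proof -
    have "\<P>(\<omega> in M. \<forall>s\<le>0. X s \<omega> = x s) = measure (distr M (count_space UNIV) (X 0)) {x 0}"
      by (subst measure_distr) (auto intro!: arg_cong[where f=X.prob])
    then show ?thesis by (simp add: X.X_initial measure_pmf_single)
  qed
  have init': "\<P>(\<omega> in M. \<forall>s\<le>0. Y s \<omega> = x s) = pmf \<nu> (x 0)" for x
  proof -
    have "\<P>(\<omega> in M. \<forall>s\<le>0. Y s \<omega> = x s) = measure (distr M (count_space UNIV) (Y 0)) {x 0}"
      by (subst measure_distr) (auto intro!: arg_cong[where f=X.prob])
    then show ?thesis by (simp add: Y.X_initial measure_pmf_single)
  qed
  show ?thesis
  proof
    show "(\<lambda>\<omega>. (X t \<omega>, Y t \<omega>)) \<in> measurable M (count_space UNIV)" for t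
      by measurable
  next
    show "distr M (count_space UNIV) (\<lambda>\<omega>. (X 0 \<omega>, Y 0 \<omega>)) = measure_pmf (pair_pmf \<mu> \<nu>)"
    proof (rule measure_eqI_countable[where A=UNIV])
      fix z
      have "emeasure (distr M (count_space UNIV) (\<lambda>\<omega>. (X 0 \<omega>, Y 0 \<omega>))) {z} =
          ennreal (\<P>(\<omega> in M. \<forall>s\<le>0. (X s \<omega>, Y s \<omega>) = z))"
        by (subst emeasure_distr) (auto simp: X.emeasure_eq_measure intro!: arg_cong[where f=X.prob])
      also have "\<dots> = ennreal (pmf (pair_pmf \<mu> \<nu>) z)"
        unfolding prod init init' by (cases z) (simp add: pmf_pair)
      finally show "emeasure (distr M (count_space UNIV) (\<lambda>\<omega>. (X 0 \<omega>, Y 0 \<omega>))) {z} =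
          emeasure (pair_pmf \<mu> \<nu>) {z}"
        by (simp add: emeasure_pmf_single)
    qed auto
  next
    show "\<P>(\<omega> in M. \<forall>s\<le>Suc t. (X s \<omega>, Y s \<omega>) = z s) =
      \<P>(\<omega> in M. \<forall>s\<le>t. (X s \<omega>, Y s \<omega>) = z s) *
      pmf ((\<lambda>(x, y). pair_pmf (K x) (L y)) (z t)) (z (Suc t))" for t z
      unfolding prod X.X_markov Y.X_markov
      by (cases "z t"; cases "z (Suc t)") (simp add: pmf_pair)
  qed
qed

text \<open>The tail sum formula for an \<open>enat\<close>-valued variable; both sides are infinite
  if with positive probability the walkers never meet.\<close>

lemma expected_meeting_time_eq_suminf:
  assumes [measurable]: "\<And>t. X t \<in> measurable M (count_space UNIV)" "\<And>t. Y t \<in> measurable M (count_space UNIV)"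
  shows "expected_meeting_time M X (Y :: nat \<Rightarrow> 'a \<Rightarrow> 's :: countable) =
    (\<Sum>t. emeasure M {\<omega> \<in> space M. \<forall>s\<le>t. X s \<omega> \<noteq> Y s \<omega>})"
proof -
  have gt: "enat t < meeting_time X Y \<omega> \<longleftrightarrow> (\<forall>s\<le>t. X s \<omega> \<noteq> Y s \<omega>)" for t \<omega>
  proof -
    have "meeting_time X Y \<omega> \<le> enat t \<longleftrightarrow> (\<exists>s\<le>t. X s \<omega> = Y s \<omega>)"
    proof
      assume le: "meeting_time X Y \<omega> \<le> enat t"
      then have ne: "enat ` {t. X t \<omega> = Y t \<omega>} \<noteq> {}"
        unfolding meeting_time_def by (auto simp: Inf_enat_def split: if_splits)
      \<comment> \<open>A nonempty set of extended naturals attains its infimum.\<close>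
      then have "meeting_time X Y \<omega> \<in> enat ` {t. X t \<omega> = Y t \<omega>}"
        unfolding meeting_time_def Inf_enat_def by (metis (mono_tags, lifting) LeastI_ex ex_in_conv)
      with le show "\<exists>s\<le>t. X s \<omega> = Y s \<omega>" by auto
    next
      assume "\<exists>s\<le>t. X s \<omega> = Y s \<omega>"
      then show "meeting_time X Y \<omega> \<le> enat t"
        unfolding meeting_time_def by (auto intro: Inf_lower2)
    qed
    then show ?thesis by (metis not_le)
  qed
  have eq: "meeting_time X Y \<omega> = enat t \<longleftrightarrow> X t \<omega> = Y t \<omega> \<and> (\<forall>s<t. X s \<omega> \<noteq> Y s \<omega>)" for t \<omega>
  proof -
    have "meeting_time X Y \<omega> = enat t \<longleftrightarrow>
        \<not> enat t < meeting_time X Y \<omega> \<and> (\<forall>s<t. enat s < meeting_time X Y \<omega>)"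
      by (cases "meeting_time X Y \<omega>") (auto simp: not_less intro: le_neq_implies_less)
    also have "\<dots> \<longleftrightarrow> X t \<omega> = Y t \<omega> \<and> (\<forall>s<t. X s \<omega> \<noteq> Y s \<omega>)"
      unfolding gt by (metis le_less_trans le_neq_implies_less order_refl)
    finally show ?thesis .
  qed
  have inf: "meeting_time X Y \<omega> = \<infinity> \<longleftrightarrow> (\<forall>t. X t \<omega> \<noteq> Y t \<omega>)" for \<omega>
  proof -
    have "meeting_time X Y \<omega> = \<infinity> \<longleftrightarrow> (\<forall>t. enat t < meeting_time X Y \<omega>)"
      by (cases "meeting_time X Y \<omega>") auto
    then show ?thesis unfolding gt by blast
  qed
  \<comment> \<open>The target is countable, so measurable fibres suffice; \<open>eq\<close> and
    \<open>inf\<close> describe them by countably many conditions.\<close>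
  have "meeting_time X Y \<in> measurable M (count_space UNIV)"
  proof (subst measurable_count_space_eq_countable, safe)
    fix k
    have "meeting_time X Y -` {k} \<inter> space M = {\<omega> \<in> space M. meeting_time X Y \<omega> = k}" by auto
    also have "\<dots> \<in> sets M"
      by (cases k) (simp_all add: eq inf)
    finally show "meeting_time X Y -` {k} \<inter> space M \<in> sets M" .
  qed auto
  from nn_integral_enat_function[OF this] show ?thesis
    by (simp add: expected_meeting_time_def gt)
qed


section \<open>Lyapunov functions on the circle\<close>

text \<open>Taking residues gives the \<open>n\<close>-periodic extension of the parabola, so
  unreduced differences of positions may be inserted.\<close>

definition circle_product :: "int \<Rightarrow> int \<Rightarrow> int" where
  "circle_product n d = (d mod n) * (n - d mod n)"

lemma circle_product_0 [simp]: "circle_product n 0 = 0"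
  by (simp add: circle_product_def)

lemma circle_product_mod [simp]: "circle_product n (d mod n) = circle_product n d"
  by (simp add: circle_product_def)

lemma circle_product_nonneg: "0 < n \<Longrightarrow> 0 \<le> circle_product n d"
  by (simp add: circle_product_def less_imp_le)

lemma circle_product_eq: "0 \<le> d \<Longrightarrow> d < n \<Longrightarrow> circle_product n d = d * (n - d)"
  by (simp add: circle_product_def)

text \<open>A crude estimate: the residue is at most \<open>n - 1\<close> and its complement at most
  \<open>n\<close>. The deficit \<open>n\<close> leaves room for the offset in
  \<open>lifted_product\<close>.\<close>

lemma circle_product_le:
  assumes "0 < n" "d mod n \<noteq> 0"
  shows "circle_product n d \<le> n * n - n"
proof -
  have "0 < d mod n" "d mod n \<le> n - 1"
    using assms pos_mod_sign[of n d] pos_mod_bound[of n d] by linarith+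
  then have "circle_product n d \<le> (n - 1) * n"
    unfolding circle_product_def by (intro mult_mono) auto
  then show ?thesis by (simp add: algebra_simps)
qed

text \<open>For \<open>d = q * n + r\<close> the left side minus the right side is
  \<open>n * q * (n - 2 * r - q * n)\<close>. The last factor is nonpositive for
  \<open>q \<ge> 1\<close> and positive for \<open>q \<le> -1\<close>.\<close>

lemma circle_product_ge:
  assumes "0 < n"
  shows "d * (n - d) \<le> circle_product n d"
proof -
  define q r where "q = d div n" and "r = d mod n"
  have d: "d = q * n + r" by (simp add: q_def r_def)
  have r: "0 \<le> r" "r < n" using assms by (simp_all add: r_def)
  have "q * (n - 2 * r - q * n) \<le> 0"
  proof (cases q "0 :: int" rule: linorder_cases)
    case greater
    then have "n \<le> q * n" using assms by simp
    then show ?thesis using r greater by (intro mult_nonneg_nonpos; linarith)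
  next
    case less
    then have "q * n \<le> - 1 * n" using assms by (intro mult_right_mono) auto
    then show ?thesis using r less by (intro mult_nonpos_nonneg; linarith)
  qed simp
  then have "n * (q * (n - 2 * r - q * n)) \<le> 0"
    using assms by (simp add: mult_le_0_iff)
  moreover have "d * (n - d) = r * (n - r) + n * (q * (n - 2 * r - q * n))"
    by (simp add: d algebra_simps)
  ultimately show ?thesis by (simp add: circle_product_def r_def)
qed

text \<open>For the parabola itself equality holds: linear terms cancel and the quadratic term costs
  \<open>2 * 1 + 2 * 1 + 4 + 4 = 12\<close>, nine times the variance. Passing to the periodic
  extension can only raise the neighbouring values.\<close>

lemma circle_product_drift:
  assumes "0 < n"
  shows "9 * circle_product n d \<le> 3 * circle_product n d + 2 * circle_product n (d + 1)
    + 2 * circle_product n (d - 1) + circle_product n (d + 2) + circle_product n (d - 2) + 12"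
proof -
  define r where "r = d mod n"
  have shift: "circle_product n (d + k) = circle_product n (r + k)"
    "circle_product n (d - k) = circle_product n (r - k)" for k
    by (simp_all add: circle_product_def r_def mod_simps)
  have "circle_product n d = r * (n - r)" by (simp add: circle_product_def r_def)
  then show ?thesis
    using circle_product_ge[OF assms, of "r + 1"] circle_product_ge[OF assms, of "r - 1"]
      circle_product_ge[OF assms, of "r + 2"] circle_product_ge[OF assms, of "r - 2"]
    unfolding shift by (simp add: algebra_simps)
qed

section \<open>The Lyapunov function for the upper bound\<close>

definition lifted_product :: "int \<Rightarrow> int \<Rightarrow> int" where
  "lifted_product n d = (if d mod n = 0 then 0 else circle_product n d + n)"

lemma lifted_product_0 [simp]: "lifted_product n 0 = 0"
  by (simp add: lifted_product_def)

lemma lifted_product_mod [simp]: "lifted_product n (d mod n) = lifted_product n d"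
  by (simp add: lifted_product_def)

lemma lifted_product_nonneg: "0 < n \<Longrightarrow> 0 \<le> lifted_product n d"
  by (simp add: lifted_product_def circle_product_nonneg)

lemma lifted_product_le:
  assumes "0 < n"
  shows "lifted_product n d \<le> n * n"
proof (cases "d mod n = 0")
  case False
  then show ?thesis using circle_product_le[OF assms False] by (simp add: lifted_product_def)
qed (simp add: lifted_product_def)

text \<open>In the interior the offset cancels and equality holds as for the parabola. At distance 1
  from the absorbing state the wrap gains \<open>2 * n\<close> with weight 1 and the offset
  \<open>n\<close> is lost with weight 2, again an equality; at distance 2 the lost offset leaves
  slack \<open>n\<close>.\<close>

lemma lifted_product_drift:
  assumes n: "5 \<le> n" and d: "d mod n \<noteq> 0"
  shows "3 * lifted_product n d + 2 * lifted_product n (d + 1) + 2 * lifted_product n (d - 1)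
    + lifted_product n (d + 2) + lifted_product n (d - 2) + 12 \<le> 9 * lifted_product n d"
proof -
  define r where "r = d mod n"
  have shift: "lifted_product n (d + k) = lifted_product n (r + k)"
    "lifted_product n (d - k) = lifted_product n (r - k)" for k
    by (simp_all add: lifted_product_def circle_product_def r_def mod_simps)
  have same: "lifted_product n d = lifted_product n r"
    by (simp add: r_def)
  have r: "0 < r" "r < n"
    using n d pos_mod_sign[of n d] pos_mod_bound[of n d] unfolding r_def by linarith+
  have inner: "lifted_product n k = k * (n - k) + n" if "0 < k" "k < n" for k
    using that by (simp add: lifted_product_def circle_product_def)
  have below: "lifted_product n (-1) = 2 * n - 1"
    using n by (simp add: lifted_product_def circle_product_def zmod_minus1)
  have above: "lifted_product n (n + k) = lifted_product n k" for k
    by (simp add: lifted_product_def circle_product_def)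
  have n0: "lifted_product n n = 0" using above[of 0] by simp
  have above1: "lifted_product n (1 + n) = 2 * n - 1"
    using above[of 1] n by (simp add: inner add.commute)
  text \<open>These five cases are distinct only for \<open>n \<ge> 5\<close>; in the first four a step reaches or crosses
    the absorbing state.\<close>
  consider "r = 1" | "r = 2" | "r = n - 1" | "r = n - 2" | "2 < r" "r < n - 2"
    using r by linarith
  then have "3 * lifted_product n r + 2 * lifted_product n (r + 1) + 2 * lifted_product n (r - 1)
    + lifted_product n (r + 2) + lifted_product n (r - 2) + 12 \<le> 9 * lifted_product n r"
  proof cases
    case 1
    then show ?thesis using n by (simp add: inner below)
  next
    case 2
    then show ?thesis using n by (simp add: inner)
  next
    case 3
    show ?thesis unfolding 3 using n by (simp add: inner n0, simp add: above1 algebra_simps)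
  next
    case 4
    show ?thesis unfolding 4 using n by (simp add: inner n0)
  next
    case 5
    then show ?thesis by (simp add: inner algebra_simps)
  qed
  then show ?thesis by (simp only: shift same)
qed

text \<open>Among the nine equally likely pairs of moves, the difference is 0 in three, each of 1
  and -1 in two, and each of 2 and -2 in one. Periodicity removes the reductions modulo
  \<open>N\<close>.\<close>

lemma nn_integral_circle_step_pair:
  fixes g :: "int \<Rightarrow> int"
  assumes periodic: "\<And>k. g (k mod int N) = g k" and nonneg: "\<And>k. 0 \<le> g k"
  shows "(\<integral>\<^sup>+ z. ennreal (g (fst z - snd z)) \<partial>pair_pmf (circle_step N x) (circle_step N y)) =
    ennreal (real_of_int (3 * g (x - y) + 2 * g (x - y + 1) + 2 * g (x - y - 1)
      + g (x - y + 2) + g (x - y - 2)) / 9)"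
proof -
  have diff: "g ((x + a) mod int N - (y + b) mod int N) = g (x - y + (a - b))" for a b
  proof -
    have "g ((x + a) mod int N - (y + b) mod int N) = g (((x + a) mod int N - (y + b) mod int N) mod int N)"
      by (simp add: periodic)
    also have "\<dots> = g ((x - y + (a - b)) mod int N)"
      by (simp add: mod_simps algebra_simps)
    finally show ?thesis by (simp add: periodic)
  qed
  have unif: "(\<integral>\<^sup>+ a. f a \<partial>pmf_of_set {-1, 0, 1 :: int}) = (f (-1) + f 0 + f 1) / 3" for f :: "int \<Rightarrow> ennreal"
    by (subst nn_integral_pmf_of_set) (auto simp: add.assoc)
  have third: "ennreal p / 3 = ennreal (p / 3)" if "0 \<le> p" for p
    using that divide_ennreal[of p 3] by simp
  let ?U = "pmf_of_set {-1, 0, 1 :: int}"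
  have "(\<integral>\<^sup>+ z. ennreal (g (fst z - snd z)) \<partial>pair_pmf (circle_step N x) (circle_step N y)) =
      (\<integral>\<^sup>+ a. (\<integral>\<^sup>+ b. ennreal (g (x - y + (a - b))) \<partial>?U) \<partial>?U)"
    by (simp add: nn_integral_pair_pmf' circle_step_def diff)
  then show ?thesis
    using nonneg
    by (simp add: unif third flip: ennreal_plus) (simp add: algebra_simps add_divide_distrib)
qed

section \<open>Averages over the circle\<close>

lemma sum_circle_product: "6 * (\<Sum>d\<in>circle N. circle_product (int N) d) = int N * (int N ^ 2 - 1)"
proof -
  \<comment> \<open>The parameter \<open>m\<close> is kept separate from the number \<open>n\<close>
    of summands so that induction on \<open>n\<close> works; both become \<open>N\<close>
    afterwards.\<close>
  have s: "6 * (\<Sum>i<n. int i * (m - int i)) = 3 * m * int n * (int n - 1) - (int n - 1) * int n * (2 * int n - 1)" for n m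
    by (induction n) (simp_all add: algebra_simps)
  have "circle N = int ` {..<N}"
    unfolding circle_def by (simp add: image_int_atLeastLessThan lessThan_atLeast0)
  then have "(\<Sum>d\<in>circle N. circle_product (int N) d) = (\<Sum>i<N. int i * (int N - int i))"
    by (simp add: sum.reindex circle_product_eq)
  then show ?thesis
    by (simp only: s) (simp add: algebra_simps power2_eq_square)
qed

lemma card_circle [simp]: "card (circle N) = N"
  by (simp add: circle_def)

lemma finite_circle [simp]: "finite (circle N)"
  by (simp add: circle_def)

lemma circle_nonempty: "0 < N \<Longrightarrow> circle N \<noteq> {}"
  by (simp add: circle_def)

text \<open>The map is its own inverse on the circle.\<close>

lemma bij_betw_circle_diff:
  assumes "0 < N"
  shows "bij_betw (\<lambda>b. (a - b) mod int N) (circle N) (circle N)"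
  by (rule bij_betwI[where g="\<lambda>b. (a - b) mod int N"])
    (use assms in \<open>auto simp: circle_def mod_simps\<close>)

text \<open>For each fixed first position \<open>a\<close> the difference is again uniform, so the
  inner integral is an average of the parabola that does not depend on \<open>a\<close>.\<close>

lemma nn_integral_uniform_circle_product:
  assumes "0 < N"
  shows "(\<integral>\<^sup>+ z. ennreal (circle_product (int N) (fst z - snd z))
      \<partial>pair_pmf (pmf_of_set (circle N)) (pmf_of_set (circle N))) = ennreal ((real N ^ 2 - 1) / 6)"
proof -
  let ?U = "pmf_of_set (circle N)"
  have "(\<integral>\<^sup>+ b. ennreal (circle_product (int N) (a - b)) \<partial>?U) = ennreal ((real N ^ 2 - 1) / 6)" for a
  proof -
    have "(\<integral>\<^sup>+ b. ennreal (circle_product (int N) (a - b)) \<partial>?U) =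
        (\<integral>\<^sup>+ d. ennreal (circle_product (int N) d) \<partial>map_pmf (\<lambda>b. (a - b) mod int N) ?U)"
      by simp
    also have "map_pmf (\<lambda>b. (a - b) mod int N) ?U = ?U"
      using assms by (intro map_pmf_of_set_bij_betw bij_betw_circle_diff circle_nonempty) auto
    also have "(\<integral>\<^sup>+ d. ennreal (circle_product (int N) d) \<partial>?U) =
        (\<Sum>d\<in>circle N. ennreal (circle_product (int N) d)) / of_nat N"
      using assms by (subst nn_integral_pmf_of_set) (auto simp: circle_nonempty)
    also have "\<dots> = ennreal (\<Sum>d\<in>circle N. circle_product (int N) d) / of_nat N"
      using assms by (subst sum_ennreal) (auto simp: circle_product_nonneg)
    also have "\<dots> = ennreal ((\<Sum>d\<in>circle N. circle_product (int N) d) / N)"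
      using assms
      by (subst divide_ennreal[symmetric]) (auto simp: circle_product_nonneg sum_nonneg ennreal_of_nat_eq_real_of_nat)
    also have "real_of_int (\<Sum>d\<in>circle N. circle_product (int N) d) = real N * (real N ^ 2 - 1) / 6"
      using arg_cong[OF sum_circle_product[of N], of real_of_int] by simp
    finally show ?thesis using assms by simp
  qed
  then show ?thesis by (simp add: nn_integral_pair_pmf')
qed

lemma set_pmf_circle_step:
  assumes "0 < N"
  shows "set_pmf (circle_step N x) \<subseteq> circle N"
  using assms by (auto simp: circle_step_def circle_def)

lemma circle_diff_mod:
  assumes "x \<in> circle N" "y \<in> circle N" "x \<noteq> y"
  shows "(x - y) mod int N \<noteq> 0"
proof
  assume "(x - y) mod int N = 0"
  then have "x mod int N = y mod int N" by (simp add: mod_eq_dvd_iff mod_0_imp_dvd)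
  then show False using assms by (simp add: circle_def)
qed

section \<open>Bounds on the expected meeting time\<close>

lemma expected_meeting_time_bounds:
  assumes "two_circle_walks M N X Y" and N: "5 \<le> N"
  shows "ennreal (real N ^ 2 / 28) \<le> expected_meeting_time M X Y"
    and "expected_meeting_time M X Y \<le> ennreal (real N ^ 2)"
proof -
  interpret W: two_circle_walks M N X Y by fact
  let ?S = "circle N \<times> circle N" and ?A = "{z :: int \<times> int. fst z = snd z}"
  let ?\<mu> = "pair_pmf (pmf_of_set (circle N)) (pmf_of_set (circle N))"
  let ?K = "\<lambda>(x, y). pair_pmf (circle_step N x) (circle_step N y)"
  \<comment> \<open>The pair itself is the Markov chain, stopped on the diagonal; the difference
    enters only through the test functions.\<close>
  interpret Z: markov_chain M ?\<mu> ?K "\<lambda>t \<omega>. (X t \<omega>, Y t \<omega>)"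
    using W.X_walk W.Y_walk W.X_Y_indep by (rule markov_chain_pair)
  have "Z.survival ?A t = emeasure M {\<omega> \<in> space M. \<forall>s\<le>t. X s \<omega> \<noteq> Y s \<omega>}" for t
    by (simp add: Z.survival_def)
  then have E: "expected_meeting_time M X Y = (\<Sum>t. Z.survival ?A t)"
    using W.X_walk W.Y_walk
    by (simp add: expected_meeting_time_eq_suminf markov_chain.X_measurable)
  have S: "set_pmf ?\<mu> \<subseteq> ?S" "\<And>z. z \<in> ?S \<Longrightarrow> set_pmf (?K z) \<subseteq> ?S"
    using N by (auto simp: circle_nonempty dest!: subsetD[OF set_pmf_circle_step, rotated])
  have ninth: "p \<le> q / 9 + 4 / 3 \<longleftrightarrow> 9 * p \<le> q + 12" "p / 9 + 4 / 3 \<le> q \<longleftrightarrow> p + 12 \<le> 9 * q"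
    for p q :: real by (simp_all add: field_simps)
  let ?g = "\<lambda>z. ennreal (circle_product (int N) (fst z - snd z))"
  \<comment> \<open>The horizon \<open>N ^ 2\<close> is chosen because it dominates
    \<open>circle_product\<close>. The factor \<open>1 + 4 / 3\<close> combines the boundary term
    with the drift.\<close>
  have "(\<integral>\<^sup>+ z. ?g z \<partial>?\<mu>) \<le> (1 + ennreal (4 / 3)) * (\<Sum>s<N ^ 2. Z.survival ?A s)"
  proof (rule Z.sum_survival_lower_bound[OF S])
    fix z assume "z \<in> ?S - ?A"
    obtain x y where z: "z = (x, y)" by (cases z)
    let ?d = "x - y"
    have "9 * circle_product (int N) ?d \<le> 3 * circle_product (int N) ?d
        + 2 * circle_product (int N) (?d + 1) + 2 * circle_product (int N) (?d - 1)
        + circle_product (int N) (?d + 2) + circle_product (int N) (?d - 2) + 12" (is "_ \<le> ?s + 12")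
      using N by (intro circle_product_drift) simp
    then have "real_of_int (9 * circle_product (int N) ?d) \<le> real_of_int (?s + 12)"
      by (simp only: of_int_le_iff)
    then have "real_of_int (circle_product (int N) ?d) \<le> real_of_int ?s / 9 + 4 / 3"
      using ninth(1)[of "real_of_int (circle_product (int N) ?d)" "real_of_int ?s"]
      by (simp only: of_int_add of_int_mult of_int_numeral)
    then have "ennreal (circle_product (int N) ?d) \<le> ennreal (real_of_int ?s / 9 + 4 / 3)"
      by (rule ennreal_leI)
    also have "\<dots> = ennreal (real_of_int ?s / 9) + ennreal (4 / 3)"
      using N by (intro ennreal_plus) (auto simp: circle_product_nonneg)
    finally show "?g z \<le> (\<integral>\<^sup>+ z. ?g z \<partial>?K z) + ennreal (4 / 3)"
      using N unfolding z prod.case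
      by (subst nn_integral_circle_step_pair) (auto simp: circle_product_nonneg)
  next
    show "?g z \<le> of_nat (N ^ 2)" for z
    proof -
      have "circle_product (int N) (fst z - snd z) \<le> int N ^ 2"
        using N circle_product_le[of "int N" "fst z - snd z"]
        by (cases "(fst z - snd z) mod int N = 0") (auto simp: circle_product_def power2_eq_square)
      then have "real_of_int (circle_product (int N) (fst z - snd z)) \<le> real (N ^ 2)"
        by (metis of_int_le_iff of_int_of_nat_eq of_nat_power)
      then show ?thesis
        unfolding ennreal_of_nat_eq_real_of_nat by (rule ennreal_leI)
    qed
  qed auto
  also have "\<dots> \<le> (1 + ennreal (4 / 3)) * expected_meeting_time M X Y"
    unfolding E by (intro mult_left_mono sum_le_suminf) auto
  also have "1 + ennreal (4 / 3) = ennreal (7 / 3)"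
    by (simp flip: ennreal_plus ennreal_1)
  finally have "ennreal ((real N ^ 2 - 1) / 6) \<le> ennreal (7 / 3) * expected_meeting_time M X Y"
    using N by (simp add: nn_integral_uniform_circle_product)
  then have "ennreal (3 / 7) * ennreal ((real N ^ 2 - 1) / 6) \<le> ennreal (3 / 7) * (ennreal (7 / 3) * expected_meeting_time M X Y)"
    by (rule mult_left_mono) simp
  also have "\<dots> = expected_meeting_time M X Y"
    by (simp add: mult.assoc[symmetric] flip: ennreal_mult)
  finally have "ennreal (3 / 7 * ((real N ^ 2 - 1) / 6)) \<le> expected_meeting_time M X Y"
    using N by (subst ennreal_mult) auto
  moreover have "real N ^ 2 / 28 \<le> 3 / 7 * ((real N ^ 2 - 1) / 6)"
  proof -
    \<comment> \<open>The claim reads \<open>N ^ 2 / 28 \<le> (N ^ 2 - 1) / 14\<close>, which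
      amounts to \<open>2 \<le> N ^ 2\<close>.\<close>
    have "2 \<le> real N ^ 2" using N power_mono[of 5 "real N" 2] by simp
    then show ?thesis by (simp add: field_simps)
  qed
  ultimately show "ennreal (real N ^ 2 / 28) \<le> expected_meeting_time M X Y"
    by (meson ennreal_leI order_trans)

  let ?h = "\<lambda>z. ennreal (lifted_product (int N) (fst z - snd z))"
  have h: "(\<integral>\<^sup>+ z. ?h z \<partial>?\<mu>) \<le> ennreal (real N ^ 2)"
  proof -
    have "lifted_product (int N) d \<le> int N ^ 2" for d
      using N lifted_product_le[of "int N" d] by (simp add: power2_eq_square)
    then have "real_of_int (lifted_product (int N) d) \<le> real N ^ 2" for d
      by (metis of_int_le_iff of_int_of_nat_eq of_nat_power)
    then have "(\<integral>\<^sup>+ z. ?h z \<partial>?\<mu>) \<le> (\<integral>\<^sup>+ z. ennreal (real N ^ 2) \<partial>?\<mu>)"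
      by (intro nn_integral_mono ennreal_leI)
    then show ?thesis by simp
  qed
  have "(\<Sum>s<t. Z.survival ?A s) \<le> ennreal (real N ^ 2)" for t
  proof -
    \<comment> \<open>The drift rate \<open>4 / 3\<close> is weakened to 1, which gives the constant
      1 in the upper bound.\<close>
    have "1 * (\<Sum>s<t. Z.survival ?A s) \<le> ennreal (4 / 3) * (\<Sum>s<t. Z.survival ?A s)"
      by (intro mult_right_mono) auto
    also have "\<dots> \<le> (\<integral>\<^sup>+ z. ?h z \<partial>?\<mu>)"
    proof (rule Z.killed_le_supermartingale[OF S])
      fix z assume zin: "z \<in> ?S - ?A"
      obtain x y where z: "z = (x, y)" by (cases z)
      let ?d = "x - y"
      have "3 * lifted_product (int N) ?d
          + 2 * lifted_product (int N) (?d + 1) + 2 * lifted_product (int N) (?d - 1)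
          + lifted_product (int N) (?d + 2) + lifted_product (int N) (?d - 2) + 12
          \<le> 9 * lifted_product (int N) ?d" (is "?s + 12 \<le> _")
        using N zin circle_diff_mod[of x N y] by (intro lifted_product_drift) (auto simp: z)
      then have "real_of_int (?s + 12) \<le> real_of_int (9 * lifted_product (int N) ?d)"
        by (simp only: of_int_le_iff)
      then have "real_of_int ?s / 9 + 4 / 3 \<le> real_of_int (lifted_product (int N) ?d)"
        using ninth(2)[of "real_of_int ?s" "real_of_int (lifted_product (int N) ?d)"]
        by (simp only: of_int_add of_int_mult of_int_numeral)
      then have "ennreal (real_of_int ?s / 9 + 4 / 3) \<le> ennreal (lifted_product (int N) ?d)"
        by (rule ennreal_leI)
      moreover have "ennreal (real_of_int ?s / 9 + 4 / 3) = ennreal (real_of_int ?s / 9) + ennreal (4 / 3)"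
        using N by (intro ennreal_plus) (auto simp: lifted_product_nonneg)
      ultimately show "(\<integral>\<^sup>+ z. ?h z \<partial>?K z) + ennreal (4 / 3) \<le> ?h z"
        using N unfolding z prod.case
        by (subst nn_integral_circle_step_pair) (auto simp: lifted_product_nonneg)
    qed auto
    finally show ?thesis using h by simp
  qed
  \<comment> \<open>The bound on the partial sums is uniform in \<open>t\<close> and passes to their
    supremum, the series.\<close>
  then show "expected_meeting_time M X Y \<le> ennreal (real N ^ 2)"
    unfolding E suminf_eq_SUP by (intro SUP_least)
qed

theorem mainTheorem3:
  "\<exists>c C :: real. 0 < c \<and> c \<le> C \<and>
     (\<forall>\<^sub>F N in sequentially.
        \<forall>(M :: 'a measure) X Y. two_circle_walks M N X Y \<longrightarrow>
          ennreal (c * real N ^ 2) \<le> expected_meeting_time M X Y \<and>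
          expected_meeting_time M X Y \<le> ennreal (C * real N ^ 2))"
proof (intro exI conjI)
  show "\<forall>\<^sub>F N in sequentially. \<forall>(M :: 'a measure) X Y. two_circle_walks M N X Y \<longrightarrow>
      ennreal (1 / 28 * real N ^ 2) \<le> expected_meeting_time M X Y \<and>
      expected_meeting_time M X Y \<le> ennreal (1 * real N ^ 2)"
    using eventually_ge_at_top[of 5]
  proof (rule eventually_mono, intro allI impI)
    fix N and M :: "'a measure" and X Y
    \<comment> \<open>The threshold 5 is inherited from \<open>lifted_product_drift\<close>.\<close>
    assume "5 \<le> N" "two_circle_walks M N X Y"
    then show "ennreal (1 / 28 * real N ^ 2) \<le> expected_meeting_time M X Y \<and>
        expected_meeting_time M X Y \<le> ennreal (1 * real N ^ 2)"
      using expected_meeting_time_bounds[of M N X Y] by simp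
  qed
qed auto

end
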